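(* Let $\mu>0$, $\kappa>0$, $k\ge \frac14$ and $\widehat{k}\ge \frac18$. Then the function $W_{\rm eH}:\mathbb{R}^{2\times 2}\to\mathbb{R}\cup\{+\infty\}$ defined by $$W_{\rm eH}(F)=\begin{cases}\dfrac{\mu}{k}\,e^{k\,\|\mathrm{dev}_2\log U\|^2}+\dfrac{\kappa}{2\widehat{k}}\,e^{\widehat{k}\,(\log\det U)^2} & \text{if } \det F>0,\\[2mm] +\infty & \text{if } \det F\le 0,\end{cases}\qquad U=\sqrt{F^TF},$$ is polyconvex.
   Context: For $F\in\mathbb{R}^{2\times2}$ with $\det F>0$, $U=\sqrt{F^TF}$ is the symmetric positive definite square root of $F^TF$, and $\log U$ is its principal (symmetric) matrix logarithm. For $X\in\mathbb{R}^{2\times 2}$, $\mathrm{dev}_2 X=X-\frac12\,\mathrm{tr}(X)\,I$, where $I$ is the $2\times 2$ identity matrix, and $\|X\|^2=\mathrm{tr}(X^TX)$ is the squared Frobenius norm. A function $W:\mathbb{R}^{2\times2}\to\mathbb{R}\cup\{+\infty\}$ is called polyconvex if there is a convex function $P:\mathbb{R}^{2\times 2}\times\mathbb{R}\to\mathbb{R}\cup\{+\infty\}$ such that $W(F)=P(F,\det F)$ for all $F\in\mathbb{R}^{2\times 2}$. *)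

theory Defs
  imports "HOL-Analysis.Analysis"
begin

(* The type class operations *, 1 and ^ on vectors are componentwise, so the library's exp is not
   the matrix exponential; powers and the exponential series are taken with respect to **. *)

primrec matrix_power :: "real^'n^'n \<Rightarrow> nat \<Rightarrow> real^'n^'n" where
  "matrix_power X 0 = mat 1"
| "matrix_power X (Suc m) = X ** matrix_power X m"

definition matrix_exp :: "real^'n^'n \<Rightarrow> real^'n^'n" where
  "matrix_exp X = (\<Sum>m. matrix_power X m /\<^sub>R fact m)"

definition symmetric_matrix :: "real^'n^'n \<Rightarrow> bool" where
  "symmetric_matrix X \<longleftrightarrow> transpose X = X"

definition spd_matrix :: "real^'n^'n \<Rightarrow> bool" where
  "spd_matrix X \<longleftrightarrow> symmetric_matrix X \<and> (\<forall>v. v \<noteq> 0 \<longrightarrow> v \<bullet> (X *v v) > 0)"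

(* The next two are meaningful (the described matrix exists and is unique) for symmetric positive
   definite arguments, and are arbitrary otherwise. *)

definition spd_sqrt :: "real^'n^'n \<Rightarrow> real^'n^'n" where
  "spd_sqrt C = (THE U. spd_matrix U \<and> U ** U = C)"

(* On symmetric positive definite matrices the principal logarithm is the unique symmetric
   preimage under the exponential. *)
definition matrix_log :: "real^'n^'n \<Rightarrow> real^'n^'n" where
  "matrix_log U = (THE L. symmetric_matrix L \<and> matrix_exp L = U)"

definition dev2 :: "real^2^2 \<Rightarrow> real^2^2" where
  "dev2 X = X - (trace X / 2) *\<^sub>R mat 1"

definition frobenius_sq :: "real^'n^'n \<Rightarrow> real" where
  "frobenius_sq X = trace (transpose X ** X)"

definition stretch :: "real^2^2 \<Rightarrow> real^2^2" where
  "stretch F = spd_sqrt (transpose F ** F)"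

definition W_eH :: "real \<Rightarrow> real \<Rightarrow> real \<Rightarrow> real \<Rightarrow> real^2^2 \<Rightarrow> ereal" where
  "W_eH \<mu> \<kappa> k k' F =
     (if det F > 0
      then ereal (\<mu> / k * exp (k * frobenius_sq (dev2 (matrix_log (stretch F))))
                  + \<kappa> / (2 * k') * exp (k' * (ln (det (stretch F)))\<^sup>2))
      else \<infinity>)"

(* Convexity of a function on the whole space with values in the reals together with +infinity:
   the value -infinity is excluded. The library's convex_on covers real-valued functions only. *)
definition convex_ereal :: "('a::real_vector \<Rightarrow> ereal) \<Rightarrow> bool" where
  "convex_ereal P \<longleftrightarrow>
     (\<forall>x. P x \<noteq> - \<infinity>) \<and>
     (\<forall>x y u v. 0 < u \<longrightarrow> 0 < v \<longrightarrow> u + v = 1 \<longrightarrow>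
        P (u *\<^sub>R x + v *\<^sub>R y) \<le> ereal u * P x + ereal v * P y)"

definition polyconvex :: "(real^2^2 \<Rightarrow> ereal) \<Rightarrow> bool" where
  "polyconvex W \<longleftrightarrow>
     (\<exists>P :: (real^2^2) \<times> real \<Rightarrow> ereal. convex_ereal P \<and> (\<forall>F. W F = P (F, det F)))"

end

theory Submission
  imports Defs
begin

text \<open>
  Let \<open>u\<^sub>1, u\<^sub>2\<close> be the singular values of \<open>F\<close> with \<open>det F > 0\<close>. Then
  \<open>\<parallel>dev\<^sub>2 log U\<parallel>\<^sup>2 = (ln u\<^sub>1 - ln u\<^sub>2)\<^sup>2 / 2 = (ln t)\<^sup>2 / 2\<close>, where
  \<open>t = max (u\<^sub>1, u\<^sub>2)\<^sup>2 / det F \<ge> 1\<close>. The largest singular value is a convex function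
  of \<open>F\<close>, and \<open>(x, y) \<mapsto> x\<^sup>2 / y\<close> is convex for \<open>y > 0\<close> and increasing in \<open>x \<ge> 0\<close>, so \<open>t\<close> is a
  convex function of \<open>(F, det F)\<close>. The function \<open>exp (a (ln t)\<^sup>2)\<close> is convex on \<open>t > 0\<close> for
  \<open>a \<ge> 1/8\<close>, because \<open>2 a s\<^sup>2 - s + 1 \<ge> 0\<close> for every \<open>s = ln t\<close>, and increasing on \<open>t \<ge> 1\<close>.
  Replacing \<open>t\<close> by \<open>max 1 t\<close> gives a convex extension to all pairs \<open>(F, \<delta>)\<close> with \<open>\<delta> > 0\<close>. The
  first term of the energy has \<open>a = k/2\<close>; the second is this function of \<open>det F\<close> itself.
\<close>

section \<open>Convexity of compositions, quotients and extended-valued functions\<close>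

text \<open>Convexity of \<open>T\<close> keeps the averaged value \<open>?w\<close> inside
  \<open>T\<close>, so monotonicity on \<open>T\<close> suffices. This matters for
  \<open>exp (a * (ln t)\<^sup>2)\<close> with \<open>a > 0\<close>, which increases on
  \<open>{1..}\<close> but decreases between 0 and 1.\<close>

lemma convex_on_mono_compose:
  fixes f :: "'a::real_vector \<Rightarrow> real" and g :: "real \<Rightarrow> real"
  assumes f: "convex_on S f" and g: "convex_on T g" and "f ` S \<subseteq> T" and mono: "mono_on T g"
  shows "convex_on S (\<lambda>x. g (f x))"
proof
  show S: "convex S" using f by (rule convex_on_imp_convex)
  have T: "convex T" using g by (rule convex_on_imp_convex)
  fix t x y assume t: "0 < t" "t < (1::real)" and xy: "x \<in> S" "y \<in> S"
  let ?z = "(1 - t) *\<^sub>R x + t *\<^sub>R y" and ?w = "(1 - t) *\<^sub>R f x + t *\<^sub>R f y"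
  have "?z \<in> S" using S t xy by (intro convexD) auto
  moreover have "?w \<in> T" using T t xy assms(3) by (intro convexD) auto
  moreover have "f ?z \<le> ?w" using convex_onD[OF f] t xy by simp
  ultimately have "g (f ?z) \<le> g ?w"
    using mono assms(3) by (auto simp: mono_on_def)
  also have "\<dots> \<le> (1 - t) * g (f x) + t * g (f y)"
    using convex_onD[OF g, of t "f x" "f y"] t xy assms(3) by (auto simp: image_subset_iff)
  finally show "g (f ?z) \<le> (1 - t) * g (f x) + t * g (f y)" .
qed

lemma convex_on_max:
  fixes f g :: "'a::real_vector \<Rightarrow> real"
  assumes f: "convex_on S f" and g: "convex_on S g"
  shows "convex_on S (\<lambda>x. max (f x) (g x))"
proof
  show "convex S" using f by (rule convex_on_imp_convex)
  fix t x y assume t: "0 < t" "t < (1::real)" and xy: "x \<in> S" "y \<in> S"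
  let ?z = "(1 - t) *\<^sub>R x + t *\<^sub>R y"
  have "f ?z \<le> (1 - t) * f x + t * f y" "g ?z \<le> (1 - t) * g x + t * g y"
    using convex_onD[OF f] convex_onD[OF g] t xy by auto
  moreover have "(1 - t) * f x + t * f y \<le> (1 - t) * max (f x) (g x) + t * max (f y) (g y)"
    "(1 - t) * g x + t * g y \<le> (1 - t) * max (f x) (g x) + t * max (f y) (g y)"
    using t by (intro add_mono mult_left_mono; simp)+
  ultimately show "max (f ?z) (g ?z) \<le> (1 - t) * max (f x) (g x) + t * max (f y) (g y)"
    by linarith
qed

text \<open>In terms of the ratios \<open>p\<close> and \<open>q\<close>, clearing the denominator
  on the left turns the gap into \<open>u * v * y * z * (p - q)\<^sup>2\<close>.\<close>

lemma sq_over_linear_le: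
  fixes a b y z u v :: real
  assumes "0 \<le> u" "0 \<le> v" "u + v = 1" "0 < y" "0 < z"
  shows "(u * a + v * b)\<^sup>2 / (u * y + v * z) \<le> u * (a\<^sup>2 / y) + v * (b\<^sup>2 / z)"
proof -
  define p q where "p = a / y" and "q = b / z"
  have a: "a = p * y" and b: "b = q * z" using assms by (auto simp: p_def q_def)
  have pos: "u * y + v * z > 0"
    using assms by (metis add_nonneg_pos add_pos_nonneg less_eq_real_def mult_nonneg_nonneg mult_pos_pos
        add_0 zero_neq_one)
  have "(u * p\<^sup>2 * y + v * q\<^sup>2 * z) * (u * y + v * z) - (u * a + v * b)\<^sup>2 = u * v * y * z * (p - q)\<^sup>2"
    unfolding a b by algebra
  moreover have "u * v * y * z * (p - q)\<^sup>2 \<ge> 0" using assms by simp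
  ultimately have "(u * a + v * b)\<^sup>2 \<le> (u * p\<^sup>2 * y + v * q\<^sup>2 * z) * (u * y + v * z)" by linarith
  then have "(u * a + v * b)\<^sup>2 / (u * y + v * z) \<le> u * p\<^sup>2 * y + v * q\<^sup>2 * z"
    using pos by (simp add: divide_le_eq)
  also have "\<dots> = u * (a\<^sup>2 / y) + v * (b\<^sup>2 / z)"
    using assms unfolding a b by (simp add: power2_eq_square)
  finally show ?thesis .
qed

text \<open>Nonnegativity of \<open>f\<close> allows its convexity inequality to be squared; joint
  convexity of the square over a positive denominator does the rest.\<close>

lemma convex_on_sq_over_linear:
  fixes f :: "'a::real_vector \<Rightarrow> real"
  assumes f: "convex_on S f" and nonneg: "\<And>x. x \<in> S \<Longrightarrow> f x \<ge> 0"
  shows "convex_on (S \<times> {0<..}) (\<lambda>z. (f (fst z))\<^sup>2 / snd z)"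
proof
  show "convex (S \<times> {0::real<..})" using f by (intro convex_Times convex_on_imp_convex) auto
  fix t and x y :: "'a \<times> real"
  assume t: "0 < t" "t < (1::real)" and xy: "x \<in> S \<times> {0<..}" "y \<in> S \<times> {0<..}"
  let ?z = "(1 - t) *\<^sub>R x + t *\<^sub>R y"
  have "fst ?z \<in> S"
    using convexD[OF convex_on_imp_convex[OF f], of "fst x" "fst y" "1 - t" t] t xy by auto
  then have "0 \<le> f (fst ?z)" by (rule nonneg)
  moreover have "f (fst ?z) \<le> (1 - t) * f (fst x) + t * f (fst y)"
    using convex_onD[OF f, of t "fst x" "fst y"] t xy by auto
  ultimately have "(f (fst ?z))\<^sup>2 \<le> ((1 - t) * f (fst x) + t * f (fst y))\<^sup>2"
    by (intro power_mono)
  moreover have "snd ?z > 0" using t xy by (auto intro!: add_pos_pos)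
  ultimately have "(f (fst ?z))\<^sup>2 / snd ?z \<le> ((1 - t) * f (fst x) + t * f (fst y))\<^sup>2 / snd ?z"
    by (intro divide_right_mono) auto
  also have "\<dots> \<le> (1 - t) * ((f (fst x))\<^sup>2 / snd x) + t * ((f (fst y))\<^sup>2 / snd y)"
    using sq_over_linear_le[of "1 - t" t "snd x" "snd y" "f (fst x)" "f (fst y)"] t xy by auto
  finally show "(f (fst ?z))\<^sup>2 / snd ?z
      \<le> (1 - t) * ((f (fst x))\<^sup>2 / snd x) + t * ((f (fst y))\<^sup>2 / snd y)" .
qed

lemma convex_on_exp_ln_sq:
  fixes a :: real
  assumes a: "a \<ge> 1/8"
  shows "convex_on {0<..} (\<lambda>t. exp (a * (ln t)\<^sup>2))"
proof (rule f''_ge0_imp_convex)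
  let ?E = "\<lambda>t. exp (a * (ln t)\<^sup>2)"
  fix t :: real assume "t \<in> {0<..}"
  then have t: "t > 0" by simp
  show "(?E has_real_derivative ?E t * (2 * a * ln t / t)) (at t)"
    using t by (auto intro!: derivative_eq_intros)
  show "((\<lambda>t. ?E t * (2 * a * ln t / t)) has_real_derivative
     2 * a * ?E t * (2 * a * (ln t)\<^sup>2 - ln t + 1) / t\<^sup>2) (at t)"
    using t by (auto intro!: derivative_eq_intros simp: field_simps power2_eq_square)
  \<comment> \<open>The quadratic in \<open>ln t\<close> has discriminant \<open>1 - 8 * a\<close>;
    at the threshold \<open>a = 1/8\<close> it is exactly the perfect square split off here.\<close>
  have "2 * a * (ln t)\<^sup>2 - ln t + 1 = 2 * (a - 1/8) * (ln t)\<^sup>2 + (ln t / 2 - 1)\<^sup>2"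
    by (simp add: power2_eq_square field_simps)
  also have "\<dots> \<ge> 0" using a by simp
  finally show "0 \<le> 2 * a * ?E t * (2 * a * (ln t)\<^sup>2 - ln t + 1) / t\<^sup>2"
    using a by simp
qed simp

lemma mono_on_exp_ln_sq:
  fixes a :: real
  assumes "a \<ge> 0"
  shows "mono_on {1..} (\<lambda>t. exp (a * (ln t)\<^sup>2))"
  using assms by (auto simp: mono_on_def intro!: mult_left_mono power_mono)

lemma convex_ereal_extend_infinity:
  assumes f: "convex_on S f"
  shows "convex_ereal (\<lambda>x. if x \<in> S then ereal (f x) else \<infinity>)"
  unfolding convex_ereal_def
proof (intro conjI allI impI)
  fix x y :: 'a and u v :: real
  assume u: "0 < u" and v: "0 < v" and uv: "u + v = 1"
  let ?P = "\<lambda>x. if x \<in> S then ereal (f x) else \<infinity>"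
  show "?P (u *\<^sub>R x + v *\<^sub>R y) \<le> ereal u * ?P x + ereal v * ?P y"
  proof (cases "x \<in> S \<and> y \<in> S")
    case True
    then have "f (u *\<^sub>R x + v *\<^sub>R y) \<le> u * f x + v * f y" "u *\<^sub>R x + v *\<^sub>R y \<in> S"
      using f u v uv by (auto simp: convex_on_def convex_def)
    with True show ?thesis by simp
  \<comment> \<open>A point outside \<open>S\<close> has positive weight and makes the right-hand
    side infinite.\<close>
  qed (use u v in auto)
qed simp

section \<open>Functional calculus for orthogonally diagonalised matrices\<close>

definition diag_matrix :: "('n::finite \<Rightarrow> real) \<Rightarrow> real^'n^'n" where
  "diag_matrix d = (\<chi> i j. if i = j then d i else 0)"

text \<open>For orthogonal \<open>R\<close>, its columns are eigenvectors with eigenvalues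
  \<open>d\<close>. Keeping \<open>R\<close> explicit lets powers and the exponential act on
  \<open>d\<close> alone.\<close>

definition spectral :: "real^'n^'n \<Rightarrow> ('n::finite \<Rightarrow> real) \<Rightarrow> real^'n^'n" where
  "spectral R d = R ** diag_matrix d ** transpose R"

lemma diag_matrix_mult: "diag_matrix d ** diag_matrix e = diag_matrix (\<lambda>i. d i * e i)"
proof -
  have "(diag_matrix d ** diag_matrix e) $ i $ j = diag_matrix (\<lambda>i. d i * e i) $ i $ j" for i j
    by (simp add: diag_matrix_def matrix_matrix_mult_def if_distrib[of "\<lambda>x. x * _"] if_distrib[of "\<lambda>x. _ * x"] cong: if_cong)
  then show ?thesis by (simp add: vec_eq_iff)
qed

lemma diag_matrix_entry [simp]:
  "(Q ** diag_matrix d) $ i $ j = Q $ i $ j * d j"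
  "(diag_matrix d ** Q) $ i $ j = d i * Q $ i $ j"
  by (simp_all add: diag_matrix_def matrix_matrix_mult_def if_distrib[of "\<lambda>x. x * _"] if_distrib[of "\<lambda>x. _ * x"] cong: if_cong)

lemma diag_matrix_mult_vector: "(diag_matrix d *v v) $ i = d i * v $ i"
  by (simp add: diag_matrix_def matrix_vector_mult_def if_distrib[of "\<lambda>x. x * _"] cong: if_cong)

lemma transpose_diag_matrix [simp]: "transpose (diag_matrix d) = diag_matrix d"
  by (simp add: diag_matrix_def transpose_def vec_eq_iff)

lemma symmetric_matrix_spectral: "symmetric_matrix (spectral R d)"
  by (simp add: symmetric_matrix_def spectral_def matrix_transpose_mul matrix_mul_assoc)

lemma spectral_mult:
  assumes "orthogonal_matrix R"
  shows "spectral R d ** spectral R e = spectral R (\<lambda>i. d i * e i)"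
proof -
  have "spectral R d ** spectral R e = R ** diag_matrix d ** (transpose R ** R) ** diag_matrix e ** transpose R"
    by (simp add: spectral_def matrix_mul_assoc)
  also have "\<dots> = R ** (diag_matrix d ** diag_matrix e) ** transpose R"
    using assms by (simp add: orthogonal_matrix matrix_mul_assoc)
  finally show ?thesis by (simp add: spectral_def diag_matrix_mult)
qed

lemma spectral_one:
  fixes R :: "real^'n^'n"
  assumes "orthogonal_matrix R"
  shows "spectral R (\<lambda>i. 1) = mat 1"
proof -
  have "diag_matrix (\<lambda>i::'n. 1) = mat 1" by (simp add: diag_matrix_def mat_def)
  with assms show ?thesis unfolding spectral_def orthogonal_matrix_def by simp
qed

lemma matrix_power_spectral:
  assumes "orthogonal_matrix R"
  shows "matrix_power (spectral R d) m = spectral R (\<lambda>i. d i ^ m)"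
  by (induction m) (simp_all add: spectral_one spectral_mult assms)

text \<open>Each entry of the matrix series is a finite linear combination of scalar exponential
  series.\<close>

lemma matrix_exp_spectral:
  assumes "orthogonal_matrix R"
  shows "matrix_exp (spectral R d) = spectral R (\<lambda>i. exp (d i))"
proof -
  have entry: "spectral R e $ i $ j = (\<Sum>l\<in>UNIV. R $ i $ l * e l * R $ j $ l)" for e i j
    by (simp add: spectral_def matrix_matrix_mult_def[of "_ ** _"] transpose_def)
  have "(\<lambda>m. (matrix_power (spectral R d) m /\<^sub>R fact m) $ i $ j) sums (spectral R (\<lambda>i. exp (d i)) $ i $ j)" for i j
  proof -
    have "(\<lambda>m. \<Sum>l\<in>UNIV. R $ i $ l * (d l ^ m /\<^sub>R fact m) * R $ j $ l) sums
        (\<Sum>l\<in>UNIV. R $ i $ l * exp (d l) * R $ j $ l)"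
      by (intro sums_sum sums_mult sums_mult2 exp_converges)
    then show ?thesis
      by (simp add: matrix_power_spectral assms entry sum_distrib_left mult_ac)
  qed
  then have "(\<lambda>m. matrix_power (spectral R d) m /\<^sub>R fact m) sums spectral R (\<lambda>i. exp (d i))"
    unfolding sums_def by (intro vec_tendstoI) simp
  then show ?thesis
    unfolding matrix_exp_def by (rule sums_unique[symmetric])
qed

text \<open>The orthogonal matrix \<open>Q\<close> linking the two eigenbases satisfies \<open>Q\<^sub>i\<^sub>j f(a\<^sub>j) = f(c\<^sub>i) Q\<^sub>i\<^sub>j\<close>;
  injectivity lets one drop \<open>f\<close> wherever \<open>Q\<^sub>i\<^sub>j \<noteq> 0\<close>.\<close>
lemma spectral_inj_on:
  assumes R: "orthogonal_matrix R" and S: "orthogonal_matrix S"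
    and f: "inj_on f T" "range a \<subseteq> T" "range c \<subseteq> T"
    and eq: "spectral R (\<lambda>i. f (a i)) = spectral S (\<lambda>i. f (c i))"
  shows "spectral R a = spectral S c"
proof -
  define Q where "Q = transpose S ** R"
  have move: "Q ** diag_matrix d = diag_matrix e ** Q \<longleftrightarrow> spectral R d = spectral S e" for d e
  proof
    assume "Q ** diag_matrix d = diag_matrix e ** Q"
    then have "S ** (Q ** diag_matrix d) ** transpose R = S ** (diag_matrix e ** Q) ** transpose R"
      by simp
    moreover have "S ** (Q ** diag_matrix d) ** transpose R = (S ** transpose S) ** spectral R d"
      by (simp add: spectral_def Q_def matrix_mul_assoc)
    moreover have "S ** (diag_matrix e ** Q) ** transpose R = spectral S e ** (R ** transpose R)"
      by (simp add: spectral_def Q_def matrix_mul_assoc)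
    ultimately show "spectral R d = spectral S e"
      using R S by (simp add: orthogonal_matrix_def)
  next
    assume "spectral R d = spectral S e"
    then have "transpose S ** spectral R d ** R = transpose S ** spectral S e ** R" by simp
    moreover have "transpose S ** spectral R d ** R = Q ** diag_matrix d ** (transpose R ** R)"
      by (simp add: spectral_def Q_def matrix_mul_assoc)
    moreover have "transpose S ** spectral S e ** R = (transpose S ** S) ** diag_matrix e ** Q"
      by (simp add: spectral_def Q_def matrix_mul_assoc)
    ultimately show "Q ** diag_matrix d = diag_matrix e ** Q"
      using R S by (simp add: orthogonal_matrix_def)
  qed
  have "Q ** diag_matrix (\<lambda>i. f (a i)) = diag_matrix (\<lambda>i. f (c i)) ** Q"
    using eq move by blast
  then have "Q $ i $ j * f (a j) = f (c i) * Q $ i $ j" for i j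
    by (metis diag_matrix_entry)
  then have "Q $ i $ j * a j = c i * Q $ i $ j" for i j
    using f by (metis inj_onD mult.commute mult_cancel_left mult_zero_left rangeI subsetD)
  then have "Q ** diag_matrix a = diag_matrix c ** Q"
    by (simp add: vec_eq_iff)
  then show ?thesis using move by blast
qed

text \<open>In the coordinates \<open>transpose R *v v\<close> the quadratic form is a sum of
  squares weighted by \<open>d\<close>; the eigenvector \<open>R *v axis i 1\<close> isolates
  \<open>d i\<close>.\<close>

lemma spd_matrix_spectral_iff:
  assumes R: "orthogonal_matrix R"
  shows "spd_matrix (spectral R d) \<longleftrightarrow> (\<forall>i. d i > 0)"
proof -
  have quad: "v \<bullet> (spectral R d *v v) = (\<Sum>i\<in>UNIV. d i * ((transpose R *v v) $ i)\<^sup>2)" for v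
  proof -
    have "v \<bullet> (spectral R d *v v) = (transpose R *v v) \<bullet> (diag_matrix d *v (transpose R *v v))"
      by (simp add: spectral_def dot_lmul_matrix flip: matrix_vector_mul_assoc)
    also have "\<dots> = (\<Sum>i\<in>UNIV. d i * ((transpose R *v v) $ i)\<^sup>2)"
      by (simp add: inner_vec_def diag_matrix_mult_vector power2_eq_square mult_ac
          del: transpose_matrix_vector)
    finally show ?thesis .
  qed
  have inv: "transpose R *v (R *v w) = w" "R *v (transpose R *v w) = w" for w
    using R by (simp_all add: matrix_vector_mul_assoc orthogonal_matrix_def del: transpose_matrix_vector)
  show ?thesis
  proof
    assume spd: "spd_matrix (spectral R d)"
    show "\<forall>i. d i > 0"
    proof
      fix i
      have "R *v axis i 1 \<noteq> 0"
        using inv(1)[of "axis i 1"] by (metis axis_eq_0_iff matrix_vector_mult_0_right zero_neq_one)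
      then have "0 < (\<Sum>j\<in>UNIV. d j * ((axis i 1 :: real^'a) $ j)\<^sup>2)"
        using spd quad[of "R *v axis i 1"] unfolding spd_matrix_def inv by metis
      also have "\<dots> = d i"
        by (simp add: axis_def if_distrib[of "\<lambda>x. _ * x"] if_distrib[of "\<lambda>x. x\<^sup>2"] cong: if_cong)
      finally show "d i > 0" .
    qed
  next
    assume d: "\<forall>i. d i > 0"
    have "0 < v \<bullet> (spectral R d *v v)" if "v \<noteq> 0" for v
    proof -
      have "transpose R *v v \<noteq> 0" using that inv(2)[of v] by fastforce
      then obtain i where "(transpose R *v v) $ i \<noteq> 0" by (auto simp: vec_eq_iff)
      then show ?thesis
        unfolding quad using d by (intro sum_pos2[of _ i]) (auto simp: less_imp_le)
    qed
    then show "spd_matrix (spectral R d)"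
      by (simp add: spd_matrix_def symmetric_matrix_spectral)
  qed
qed

lemma det_spectral:
  assumes "orthogonal_matrix R"
  shows "det (spectral R d) = (\<Prod>i\<in>UNIV. d i)"
proof -
  have "det R * det R = 1"
    using det_orthogonal_matrix[OF assms] by auto
  then show ?thesis
    by (simp add: spectral_def det_mul det_transpose diag_matrix_def det_diagonal)
qed

lemma trace_spectral:
  assumes "orthogonal_matrix R"
  shows "trace (spectral R d) = (\<Sum>i\<in>UNIV. d i)"
proof -
  have "trace (spectral R d) = trace (transpose R ** R ** diag_matrix d)"
    unfolding spectral_def by (subst trace_mul_sym) (simp add: matrix_mul_assoc)
  then show ?thesis
    using assms by (simp add: orthogonal_matrix_def trace_def diag_matrix_def)
qed

text \<open>Writing the matrix as \<open>m I + \<rho> (cos \<phi>, sin \<phi>; sin \<phi>, - cos \<phi>)\<close>,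
  the rotation by \<open>\<phi>/2\<close> diagonalises it.\<close>
lemma symmetric_matrix_2_spectral:
  fixes X :: "real^2^2"
  assumes "symmetric_matrix X"
  obtains R d where "orthogonal_matrix R" "X = spectral R d"
proof -
  obtain \<rho> \<phi> where pol: "(X $ 1 $ 1 - X $ 2 $ 2) / 2 = \<rho> * cos \<phi>" "X $ 1 $ 2 = \<rho> * sin \<phi>"
    using polar_Ex by blast
  define c s where "c = cos (\<phi> / 2)" and "s = sin (\<phi> / 2)"
  have cs: "c\<^sup>2 + s\<^sup>2 = 1" by (simp add: c_def s_def)
  have dbl: "cos \<phi> = c\<^sup>2 - s\<^sup>2" "sin \<phi> = 2 * s * c"
    using cos_double[of "\<phi> / 2"] sin_double[of "\<phi> / 2"] by (simp_all add: c_def s_def)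
  define m where "m = (X $ 1 $ 1 + X $ 2 $ 2) / 2"
  define R :: "real^2^2" where "R = vector [vector [c, - s], vector [s, c]]"
  define d :: "2 \<Rightarrow> real" where "d i = (if i = 1 then m + \<rho> else m - \<rho>)" for i
  have sym: "X $ 2 $ 1 = X $ 1 $ 2"
    using assms by (auto simp: symmetric_matrix_def transpose_def vec_eq_iff)
  have "orthogonal_matrix R"
    using cs by (simp add: orthogonal_matrix R_def matrix_matrix_mult_def transpose_def mat_def
        vec_eq_iff forall_2 sum_2 power2_eq_square add.commute)
  moreover have "X = spectral R d"
  proof -
    have e: "spectral R d $ i $ j = R $ i $ 1 * (m + \<rho>) * R $ j $ 1 + R $ i $ 2 * (m - \<rho>) * R $ j $ 2" for i j
      by (simp add: spectral_def matrix_matrix_mult_def[of "_ ** _"] transpose_def sum_2 d_def)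
    have "X $ 1 $ 1 = m * (c\<^sup>2 + s\<^sup>2) + \<rho> * (c\<^sup>2 - s\<^sup>2)" "X $ 2 $ 2 = m * (c\<^sup>2 + s\<^sup>2) - \<rho> * (c\<^sup>2 - s\<^sup>2)"
      using pol(1) unfolding cs dbl(1) m_def by (simp_all add: field_simps)
    moreover have "X $ 1 $ 2 = \<rho> * (2 * s * c)" using pol(2) dbl(2) by simp
    ultimately show ?thesis
      unfolding vec_eq_iff forall_2 e sym
      by (simp add: R_def power2_eq_square algebra_simps)
  qed
  ultimately show ?thesis using that by blast
qed

section \<open>Square root, logarithm and deviator in dimension two\<close>

lemma spd_sqrt_spectral:
  fixes R :: "real^2^2"
  assumes R: "orthogonal_matrix R" and u: "\<And>i. u i > 0"
  shows "spd_sqrt (spectral R (\<lambda>i. (u i)\<^sup>2)) = spectral R u"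
  unfolding spd_sqrt_def
proof (rule the_equality)
  show "spd_matrix (spectral R u) \<and> spectral R u ** spectral R u = spectral R (\<lambda>i. (u i)\<^sup>2)"
    using assms by (simp add: spd_matrix_spectral_iff spectral_mult power2_eq_square)
next
  \<comment> \<open>Uniqueness: a competing root has its own eigenbasis \<open>S\<close>, and
    squaring is injective on positive eigenvalues.\<close>
  fix U assume U: "spd_matrix U \<and> U ** U = spectral R (\<lambda>i. (u i)\<^sup>2)"
  then obtain S w where S: "orthogonal_matrix S" "U = spectral S w"
    using symmetric_matrix_2_spectral spd_matrix_def by metis
  have "\<forall>i. w i > 0" using U S spd_matrix_spectral_iff by blast
  moreover have "spectral S (\<lambda>i. (w i)\<^sup>2) = spectral R (\<lambda>i. (u i)\<^sup>2)"
    using U S by (simp add: spectral_mult power2_eq_square)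
  moreover have "inj_on (\<lambda>t::real. t\<^sup>2) {0<..}"
    by (auto simp: inj_on_def power2_eq_iff)
  ultimately have "spectral S w = spectral R u"
    using u by (rule_tac spectral_inj_on[OF S(1) R, of "\<lambda>t. t\<^sup>2" "{0<..}" w u]) (auto)
  then show "U = spectral R u" using S by simp
qed

lemma matrix_log_spectral:
  fixes R :: "real^2^2"
  assumes R: "orthogonal_matrix R" and u: "\<And>i. u i > 0"
  shows "matrix_log (spectral R u) = spectral R (\<lambda>i. ln (u i))"
  unfolding matrix_log_def
proof (rule the_equality)
  show "symmetric_matrix (spectral R (\<lambda>i. ln (u i))) \<and>
      matrix_exp (spectral R (\<lambda>i. ln (u i))) = spectral R u"
    using assms by (simp add: symmetric_matrix_spectral matrix_exp_spectral)
next
  \<comment> \<open>Uniqueness again by diagonalising the competitor, now with \<open>exp\<close>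
    injective on all reals.\<close>
  fix L assume L: "symmetric_matrix L \<and> matrix_exp L = spectral R u"
  then obtain S w where S: "orthogonal_matrix S" "L = spectral S w"
    using symmetric_matrix_2_spectral by metis
  have "spectral S (\<lambda>i. exp (w i)) = spectral R (\<lambda>i. exp (ln (u i)))"
    using L S u by (simp add: matrix_exp_spectral)
  then have "spectral S w = spectral R (\<lambda>i. ln (u i))"
    by (rule spectral_inj_on[OF S(1) R, of exp UNIV, rotated 3]) (auto simp: inj_on_def)
  then show "L = spectral R (\<lambda>i. ln (u i))" using S by simp
qed

text \<open>Supplies the singular values \<open>u\<close> of \<open>F\<close>. Since
  \<open>det F > 0\<close> makes \<open>F\<close> injective, \<open>transpose F ** F\<close> is
  positive definite.\<close>

lemma stretch_spectral:
  assumes F: "det F > 0"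
  obtains R u where "orthogonal_matrix R" "\<And>i. u i > 0" "stretch F = spectral R u"
    "transpose F ** F = spectral R (\<lambda>i. (u i)\<^sup>2)"
proof -
  have "symmetric_matrix (transpose F ** F)"
    by (simp add: symmetric_matrix_def matrix_transpose_mul)
  then obtain R d where R: "orthogonal_matrix R" "transpose F ** F = spectral R d"
    by (rule symmetric_matrix_2_spectral)
  have "spd_matrix (transpose F ** F)"
    unfolding spd_matrix_def
  proof (intro conjI allI impI)
    fix v :: "real^2" assume "v \<noteq> 0"
    then have "F *v v \<noteq> 0"
      using F by (metis invertible_det_nz invertible_def less_irrefl matrix_vector_mul_assoc
          matrix_vector_mul_lid matrix_vector_mult_0_right)
    moreover have "v \<bullet> (transpose F ** F *v v) = (F *v v) \<bullet> (F *v v)"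
      by (simp add: dot_lmul_matrix flip: matrix_vector_mul_assoc)
        (metis dot_lmul_matrix inner_commute transpose_matrix_vector)
    ultimately show "0 < v \<bullet> (transpose F ** F *v v)" by simp
  qed fact
  then have d: "d i > 0" for i using R spd_matrix_spectral_iff by metis
  define u where "u i = sqrt (d i)" for i
  have u: "u i > 0" "(u i)\<^sup>2 = d i" for i using d[of i] by (simp_all add: u_def less_imp_le)
  have "stretch F = spectral R u"
    using spd_sqrt_spectral[OF R(1), of u] u by (simp add: stretch_def R(2))
  then show ?thesis using that[of R u] R u by simp
qed

text \<open>Pythagoras: \<open>dev2 X\<close> is Frobenius-orthogonal to \<open>mat 1\<close>, whose
  squared norm is 2.\<close>

lemma frobenius_sq_dev2:
  fixes X :: "real^2^2"
  shows "frobenius_sq (dev2 X) = frobenius_sq X - (trace X)\<^sup>2 / 2"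
  by (simp add: frobenius_sq_def dev2_def trace_def matrix_matrix_mult_def transpose_def mat_def sum_2
      power2_eq_square field_simps)

lemma frobenius_sq_dev2_spectral:
  fixes R :: "real^2^2"
  assumes "orthogonal_matrix R"
  shows "frobenius_sq (dev2 (spectral R d)) = (d 1 - d 2)\<^sup>2 / 2"
proof -
  have "frobenius_sq (spectral R d) = (d 1)\<^sup>2 + (d 2)\<^sup>2"
    using symmetric_matrix_spectral[of R d]
    by (simp add: frobenius_sq_def symmetric_matrix_def spectral_mult trace_spectral assms sum_2
        power2_eq_square)
  then show ?thesis
    by (simp add: frobenius_sq_dev2 trace_spectral assms sum_2 power2_eq_square field_simps)
qed

section \<open>The largest singular value as a convex function\<close>

text \<open>On the complex plane \<open>F\<close> acts as z -> \<alpha> z + \<beta> conj(z). This is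
  2|\<alpha>|, and \<open>anticonformal_norm\<close> is 2|\<beta>|; both are norms of linear
  functions of \<open>F\<close>.\<close>

definition conformal_norm :: "real^2^2 \<Rightarrow> real" where
  "conformal_norm F = norm (Complex (F $ 1 $ 1 + F $ 2 $ 2) (F $ 1 $ 2 - F $ 2 $ 1))"

definition anticonformal_norm :: "real^2^2 \<Rightarrow> real" where
  "anticonformal_norm F = norm (Complex (F $ 1 $ 1 - F $ 2 $ 2) (F $ 1 $ 2 + F $ 2 $ 1))"

text \<open>The two norms are \<open>u\<^sub>1 + u\<^sub>2\<close> and \<open>\<bar>u\<^sub>1 - u\<^sub>2\<bar>\<close> when \<open>det F > 0\<close>; this form makes convexity
  of the largest singular value evident.\<close>
definition max_stretch :: "real^2^2 \<Rightarrow> real" where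
  "max_stretch F = (conformal_norm F + anticonformal_norm F) / 2"

lemma convex_on_norm_linear:
  assumes "linear L"
  shows "convex_on UNIV (\<lambda>x. norm (L x))"
proof
  fix t x y assume "0 < t" "t < (1::real)"
  then show "norm (L ((1 - t) *\<^sub>R x + t *\<^sub>R y)) \<le> (1 - t) * norm (L x) + t * norm (L y)"
    using norm_triangle_ineq[of "(1 - t) *\<^sub>R L x" "t *\<^sub>R L y"]
    by (simp add: linear_add[OF assms] linear_scale[OF assms])
qed simp

lemma convex_on_max_stretch: "convex_on UNIV max_stretch"
proof -
  have "convex_on UNIV (\<lambda>F. (conformal_norm F + anticonformal_norm F) / 2)"
    unfolding conformal_norm_def anticonformal_norm_def
    by (intro convex_on_cdiv convex_on_add convex_on_norm_linear linearI)
      (auto simp: complex_eq_iff algebra_simps)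
  then show ?thesis by (simp add: max_stretch_def[abs_def])
qed

lemma max_stretch_nonneg: "max_stretch F \<ge> 0"
  by (simp add: max_stretch_def conformal_norm_def anticonformal_norm_def)

lemma conformal_norm_sq:
  "(conformal_norm F)\<^sup>2 = trace (transpose F ** F) + 2 * det F"
  "(anticonformal_norm F)\<^sup>2 = trace (transpose F ** F) - 2 * det F"
  unfolding conformal_norm_def anticonformal_norm_def cmod_power2
  by (simp_all add: trace_def matrix_matrix_mult_def transpose_def sum_2 det_2 power2_eq_square
      algebra_simps)

text \<open>The matrix \<open>transpose F ** F\<close> determines only the square of
  \<open>det F\<close>; positivity fixes the sign.\<close>

lemma det_eq_prod_stretch:
  assumes "orthogonal_matrix R" "\<And>i. u i > 0" "transpose F ** F = spectral R (\<lambda>i. (u i)\<^sup>2)" "det F > 0"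
  shows "det F = u 1 * u (2::2)"
proof -
  have "(det F)\<^sup>2 = (u 1 * u 2)\<^sup>2"
    using arg_cong[OF assms(3), of det] det_spectral[OF assms(1), of "\<lambda>i. (u i)\<^sup>2"]
    by (simp add: det_mul det_transpose UNIV_2 power2_eq_square)
  then show ?thesis
    by (rule power2_eq_imp_eq) (use assms(2)[of 1] assms(2)[of 2] assms(4) in auto)
qed

text \<open>The maximum is half of the sum plus the absolute difference, and each of these is
  recovered from its square by nonnegativity.\<close>

lemma max_stretch_eq_max:
  assumes "orthogonal_matrix R" "\<And>i. u i > 0" "transpose F ** F = spectral R (\<lambda>i. (u i)\<^sup>2)" "det F > 0"
  shows "max_stretch F = max (u 1) (u (2::2))"
proof -
  have tr: "trace (transpose F ** F) = (u 1)\<^sup>2 + (u 2)\<^sup>2"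
    using trace_spectral[OF assms(1), of "\<lambda>i. (u i)\<^sup>2"] by (simp add: assms(3) sum_2)
  have det: "det F = u 1 * u 2" using assms by (rule det_eq_prod_stretch)
  have "(conformal_norm F)\<^sup>2 = (u 1 + u 2)\<^sup>2" "(anticonformal_norm F)\<^sup>2 = \<bar>u 1 - u 2\<bar>\<^sup>2"
    unfolding conformal_norm_sq tr det by (simp_all add: power2_eq_square algebra_simps)
  moreover have "u 1 + u 2 \<ge> 0" using assms(2)[of 1] assms(2)[of 2] by simp
  moreover have "conformal_norm F \<ge> 0" "anticonformal_norm F \<ge> 0"
    by (simp_all add: conformal_norm_def anticonformal_norm_def)
  ultimately have "conformal_norm F = u 1 + u 2" "anticonformal_norm F = \<bar>u 1 - u 2\<bar>"
    using power2_eq_imp_eq abs_ge_zero by blast+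
  then show ?thesis by (simp add: max_stretch_def max_def)
qed

section \<open>The energy as a convex function of \<open>F\<close> and its determinant\<close>

text \<open>At \<open>(F, det F)\<close> the quotient is the larger singular value over the smaller,
  hence at least 1 and unchanged by \<open>max 1\<close>. The factor 1/2 in the deviatoric norm
  turns \<open>k\<close> into \<open>k / 2\<close>.\<close>

lemma W_eH_eq:
  assumes F: "det F > 0"
  shows "W_eH \<mu> \<kappa> k k' F =
    ereal (\<mu> / k * exp (k / 2 * (ln (max 1 ((max_stretch F)\<^sup>2 / det F)))\<^sup>2)
      + \<kappa> / (2 * k') * exp (k' * (ln (det F))\<^sup>2))"
proof -
  obtain R u where R: "orthogonal_matrix R" and u: "\<And>i. u i > 0" and st: "stretch F = spectral R u"
    and C: "transpose F ** F = spectral R (\<lambda>i. (u i)\<^sup>2)"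
    using stretch_spectral[OF F] by metis
  have det: "det F = u 1 * u 2" using R u C F by (rule det_eq_prod_stretch)
  have ms: "max_stretch F = max (u 1) (u 2)" using R u C F by (rule max_stretch_eq_max)
  have pos: "u 1 > 0" "u 2 > 0" using u by auto
  have "(ln (max 1 ((max_stretch F)\<^sup>2 / det F)))\<^sup>2 = (ln (u 1) - ln (u 2))\<^sup>2"
  proof (cases "u 1 \<ge> u 2")
    case True
    then have "max 1 ((max_stretch F)\<^sup>2 / det F) = u 1 / u 2"
      using pos by (simp add: ms det power2_eq_square max_def)
    then show ?thesis using pos by (simp add: ln_div)
  next
    case False
    then have "max 1 ((max_stretch F)\<^sup>2 / det F) = u 2 / u 1"
      using pos by (simp add: ms det power2_eq_square max_def)
    then show ?thesis using pos by (simp add: ln_div power2_commute)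
  qed
  moreover have "frobenius_sq (dev2 (matrix_log (stretch F))) = (ln (u 1) - ln (u 2))\<^sup>2 / 2"
    by (simp add: st matrix_log_spectral R u frobenius_sq_dev2_spectral)
  moreover have "det (stretch F) = det F"
    by (simp add: st det_spectral R det UNIV_2)
  ultimately show ?thesis using F by (simp add: W_eH_def)
qed

theorem theorem3p4:
  fixes \<mu> \<kappa> k k' :: real
  assumes "\<mu> > 0" and "\<kappa> > 0" and "k \<ge> 1/4" and "k' \<ge> 1/8"
  shows "polyconvex (W_eH \<mu> \<kappa> k k')"
proof -
  \<comment> \<open>The second component is an independent positive variable here, not tied to the
    determinant of the first.\<close>
  let ?S = "UNIV \<times> {0<..} :: ((real^2^2) \<times> real) set"
  let ?f = "\<lambda>z. \<mu> / k * exp (k / 2 * (ln (max 1 ((max_stretch (fst z))\<^sup>2 / snd z)))\<^sup>2)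
      + \<kappa> / (2 * k') * exp (k' * (ln (snd z))\<^sup>2)"
  have S: "convex ?S" by (intro convex_Times) auto
  have "convex_on ?S (\<lambda>z. max 1 ((max_stretch (fst z))\<^sup>2 / snd z))"
    using S by (intro convex_on_max convex_on_sq_over_linear convex_on_max_stretch max_stretch_nonneg)
      (simp add: convex_on_const)
  \<comment> \<open>The bound \<open>k \<ge> 1/4\<close> gives \<open>k / 2 \<ge> 1/8\<close>, and
    \<open>max 1\<close> places the inner values in \<open>{1..}\<close>, where the outer function
    is both convex and increasing.\<close>
  then have "convex_on ?S (\<lambda>z. exp (k / 2 * (ln (max 1 ((max_stretch (fst z))\<^sup>2 / snd z)))\<^sup>2))"
    using assms
    by (rule_tac convex_on_mono_compose[where T = "{1..}" and g = "\<lambda>t. exp (k / 2 * (ln t)\<^sup>2)"])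
      (auto intro!: convex_on_subset[OF convex_on_exp_ln_sq] mono_on_exp_ln_sq simp del: times_divide_eq_left)
  \<comment> \<open>This term depends linearly on the pair before the outer function is applied, so
    convexity on the positive reals is enough, without monotonicity.\<close>
  moreover have "convex_on ?S (\<lambda>z. exp (k' * (ln (snd z))\<^sup>2))"
    using convex_on_exp_ln_sq[OF assms(4)] S by (auto simp: convex_on_def)
  ultimately have "convex_on ?S ?f"
    using assms by (intro convex_on_add convex_on_cmul) auto
  then have "convex_ereal (\<lambda>z. if z \<in> ?S then ereal (?f z) else \<infinity>)"
    by (rule convex_ereal_extend_infinity)
  moreover have "W_eH \<mu> \<kappa> k k' F = (if (F, det F) \<in> ?S then ereal (?f (F, det F)) else \<infinity>)" for F
    by (cases "det F > 0") (simp_all add: W_eH_eq, simp add: W_eH_def)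
  ultimately show ?thesis
    unfolding polyconvex_def by (intro exI[of _ "\<lambda>z. if z \<in> ?S then ereal (?f z) else \<infinity>"]) blast
qed

end
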